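(* There is an absolute constant $C$ such that for every $n$-vertex graph $G$, $\mathrm{fc}_+(\mathrm{IndependentSet}(G),2\sqrt n)\le Cn$; that is, $\mathrm{IndependentSet}(G)$ has a factor-$2\sqrt n$ LP relaxation with $O(n)$ inequalities.
   Context: For a graph $G=(V,E)$, $\mathrm{IndependentSet}(G)$ is the maximization problem whose feasible solutions are all independent sets $I$ of $G$, with one instance $\mathcal I(H)$ for each induced subgraph $H$ of $G$ and $\mathrm{Val}_{\mathcal I(H)}(I)=|I\cap V(H)|$; $\mathrm{OPT}(\mathcal I)=\max_I\mathrm{Val}_{\mathcal I}(I)$. For $\rho\ge1$, a factor-$\rho$ LP relaxation of this maximization problem is a linear system $Ax\ge b$ in $\mathbb R^d$ ($d$ arbitrary) with vectors $x^I$ satisfying $Ax^I\ge b$ for every independent set $I$ and affine functions $f_{\mathcal I}$ with $f_{\mathcal I}(x^I)=\mathrm{Val}_{\mathcal I}(I)$ for all $I,\mathcal I$, such that $\max\{f_{\mathcal I}(x):Ax\ge b\}\le\rho\,\mathrm{OPT}(\mathcal I)$ for every instance. The size is the number of inequalities (the system may be arbitrary, with no bound on the computation needed to construct it); $\mathrm{fc}_+(\Pi,\rho)$ is the minimum size of a factor-$\rho$ LP relaxation. *)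

theory Defs
  imports
    Complex_Main
    "HOL-Library.Extended_Nat"
    "Graph_Theory.Digraph_Component"
    "Jordan_Normal_Form.Matrix"
begin

section \<open>Maximization problems\<close>

record ('s, 'i) max_problem =
  solutions :: "'s set"
  instances :: "'i set"
  Val :: "'i \<Rightarrow> 's \<Rightarrow> real"

text \<open>Intended for problems with a finite nonempty set of feasible solutions.\<close>

definition OPT :: "('s, 'i) max_problem \<Rightarrow> 'i \<Rightarrow> real" where
  "OPT P i = Max (Val P i ` solutions P)"


section \<open>LP relaxations\<close>

text \<open>The order on vectors is the componentwise one and includes equality of the dimensions,
  so the system has \<^term>\<open>dim_row A\<close> inequalities in \<^term>\<open>dim_col A\<close> variables.\<close>

definition polyhedron :: "real mat \<Rightarrow> real vec \<Rightarrow> real vec set" where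
  "polyhedron A b = {x \<in> carrier_vec (dim_col A). A *\<^sub>v x \<ge> b}"

definition affine_function :: "nat \<Rightarrow> (real vec \<Rightarrow> real) \<Rightarrow> bool" where
  "affine_function d f \<longleftrightarrow>
     (\<exists>c \<in> carrier_vec d. \<exists>c0. \<forall>x \<in> carrier_vec d. f x = c \<bullet> x + c0)"

text \<open>The factor is meant to be at least 1, as otherwise a problem having an instance
  with positive optimum admits no relaxation. The bound on the LP value is stated for an
  optimal solution of the LP, so the maximum is required to be attained.\<close>

definition lp_relaxation ::
  "('s, 'i) max_problem \<Rightarrow> real \<Rightarrow> real mat \<Rightarrow> real vec \<Rightarrow> bool" where
  "lp_relaxation P \<rho> A b \<longleftrightarrow>
     dim_vec b = dim_row A \<and>
     (\<exists>(x :: 's \<Rightarrow> real vec) (f :: 'i \<Rightarrow> real vec \<Rightarrow> real).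
        (\<forall>s \<in> solutions P. x s \<in> polyhedron A b) \<and>
        (\<forall>i \<in> instances P.
           affine_function (dim_col A) (f i) \<and>
           (\<forall>s \<in> solutions P. f i (x s) = Val P i s) \<and>
           (\<exists>y. is_arg_max (f i) (\<lambda>z. z \<in> polyhedron A b) y \<and> f i y \<le> \<rho> * OPT P i)))"

text \<open>The minimum is taken in \<^typ>\<open>enat\<close>: it is \<^term>\<open>\<infinity>\<close> if there is no relaxation,
  and it is attained otherwise.\<close>

definition fc_plus :: "('s, 'i) max_problem \<Rightarrow> real \<Rightarrow> enat" where
  "fc_plus P \<rho> = Inf {enat (dim_row A) | A b. lp_relaxation P \<rho> A b}"


section \<open>The independent set problem\<close>

text \<open>Finite simple graphs are the loop-free symmetric digraphs without parallel arcs,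
  i.e. the locale \<^locale>\<open>graph\<close>.\<close>

definition independent_set :: "('a, 'b) pre_digraph \<Rightarrow> 'a set \<Rightarrow> bool" where
  "independent_set G I \<longleftrightarrow> I \<subseteq> verts G \<and> (\<forall>u \<in> I. \<forall>v \<in> I. \<not> u \<rightarrow>\<^bsub>G\<^esub> v)"

definition IndependentSet ::
  "('a, 'b) pre_digraph \<Rightarrow> ('a set, ('a, 'b) pre_digraph) max_problem" where
  "IndependentSet G =
     \<lparr> solutions = {I. independent_set G I},
       instances = {H. induced_subgraph H G},
       Val = (\<lambda>H I. real (card (I \<inter> verts H))) \<rparr>"

end

theory Submission
  imports Defs
begin

text \<open>Remove independent sets of more than \<open>\<surd>n\<close> vertices from the graph until none is left. At most
  \<open>\<surd>n\<close> sets are removed, and each of them meets the vertex set \<open>S\<close> of an induced subgraph in an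
  independent set, i.e. in at most \<open>OPT\<close> vertices. On the set \<open>W\<close> of remaining vertices, the single
  inequality \<open>x(W) \<le> \<surd>n\<close> is valid, and \<open>OPT \<ge> 1\<close> if \<open>S\<close> meets \<open>W\<close>. So the inequalities \<open>x \<ge> 0\<close>,
  \<open>x(W) \<le> \<surd>n\<close> and \<open>x\<^sub>v \<le> 1\<close> for \<open>v \<notin> W\<close> imply \<open>x(S) \<le> \<surd>n \<cdot> OPT + \<surd>n \<cdot> OPT\<close>.\<close>

section \<open>Greedy removal of large sets\<close>

text \<open>As long as some subset of \<open>V\<close> with more than \<open>t\<close> elements
  satisfies \<open>P\<close>, it is put into \<open>F\<close> and its elements are deleted. Every
  deletion uses up more than \<open>t\<close> elements, which bounds \<open>card F\<close>; the set
  left at the end is \<open>W\<close>.\<close>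

lemma greedy_decomposition:
  fixes t :: real
  assumes "finite V" "0 \<le> t"
  shows "\<exists>F W. finite F \<and> (\<forall>I\<in>F. P I) \<and> W \<subseteq> V \<and> V - W \<subseteq> \<Union>F \<and>
           real (card F) * t \<le> real (card V) \<and> (\<forall>I\<subseteq>W. P I \<longrightarrow> real (card I) \<le> t)"
  using assms(1)
proof (induction V rule: finite_psubset_induct)
  case (psubset V)
  show ?case
  proof (cases "\<exists>I\<subseteq>V. P I \<and> t < real (card I)")
    case False
    then show ?thesis
      by (intro exI[of _ "{}"] exI[of _ V]) (auto simp: not_less)
  next
    case True
    then obtain I where I: "I \<subseteq> V" "P I" "t < real (card I)" by blast
    have "I \<noteq> {}" using I(3) assms(2) by auto
    then have "V - I \<subset> V" using I(1) by blast
    from psubset.IH[OF this] obtain F W where FW: "finite F" "\<forall>I\<in>F. P I" "W \<subseteq> V - I"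
      "V - I - W \<subseteq> \<Union>F" "real (card F) * t \<le> real (card (V - I))"
      "\<forall>I\<subseteq>W. P I \<longrightarrow> real (card I) \<le> t" by blast
    have "finite I" using I(1) psubset.hyps finite_subset by blast
    then have "real (card V) = real (card (V - I)) + real (card I)"
      using I(1) psubset.hyps card_mono[of V I] by (simp add: card_Diff_subset)
    \<comment> \<open>Only an upper bound: the induction hypothesis does not exclude
      \<open>I \<in> F\<close>.\<close>
    moreover have "real (card (insert I F)) * t \<le> (real (card F) + 1) * t"
      using card_insert_le_m1[of "Suc (card F)" F I] assms(2) FW(1)
      by (intro mult_right_mono) (auto simp: card_insert_if)
    ultimately have "real (card (insert I F)) * t \<le> real (card V)"
      using FW(5) I(3) by (simp add: algebra_simps)
    then show ?thesis
      using FW I by (intro exI[of _ "insert I F"] exI[of _ W]) auto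
  qed
qed

section \<open>The capped polyhedron and its linear maxima\<close>

text \<open>Serves in two roles: as the point that represents a solution, and as the coefficient
  vector of a constraint or an objective.\<close>

definition indicator_vec :: "nat \<Rightarrow> nat set \<Rightarrow> real vec" where
  "indicator_vec n T = vec n (\<lambda>i. if i \<in> T then 1 else 0)"

lemma indicator_vec_carrier [simp]: "indicator_vec n T \<in> carrier_vec n"
  by (simp add: indicator_vec_def)

lemma indicator_vec_index [simp]: "i < n \<Longrightarrow> indicator_vec n T $ i = (if i \<in> T then 1 else 0)"
  by (simp add: indicator_vec_def)

lemma indicator_vec_scalar_prod:
  assumes "x \<in> carrier_vec n" "T \<subseteq> {..<n}"
  shows "indicator_vec n T \<bullet> x = (\<Sum>i\<in>T. x $ i)"
proof -
  have "indicator_vec n T \<bullet> x = (\<Sum>i\<in>{0..<n}. if i \<in> T then x $ i else 0)"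
    using assms(1) by (auto simp: scalar_prod_def intro!: sum.cong)
  also have "\<dots> = (\<Sum>i\<in>{0..<n} \<inter> T. x $ i)" by (simp add: sum.inter_restrict)
  also have "{0..<n} \<inter> T = T" using assms(2) by auto
  finally show ?thesis .
qed

text \<open>The inequality \<open>x(W) \<le> c\<close> is repeated for every index in \<open>W\<close>, so that there are \<open>2 * n\<close> rows
  even if \<open>n = 0\<close>.\<close>

definition cap_row :: "nat set \<Rightarrow> nat \<Rightarrow> nat set" where
  "cap_row W i = (if i \<in> W then W else {i})"

text \<open>Since the system has the form \<open>A x \<ge> b\<close>, the upper bounds in the second
  block of rows are negated, and so are their right-hand sides in \<open>cap_bound\<close>.\<close>

definition cap_matrix :: "nat \<Rightarrow> nat set \<Rightarrow> real mat" where
  "cap_matrix n W = mat_of_rows n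
     (map (\<lambda>i. indicator_vec n {i}) [0..<n] @ map (\<lambda>i. - indicator_vec n (cap_row W i)) [0..<n])"

definition cap_bound :: "nat \<Rightarrow> nat set \<Rightarrow> real \<Rightarrow> real vec" where
  "cap_bound n W c = vec (2 * n) (\<lambda>i. if i < n then 0 else if i - n \<in> W then - c else - 1)"

lemma dim_cap_matrix [simp]: "dim_row (cap_matrix n W) = 2 * n" "dim_col (cap_matrix n W) = n"
  by (auto simp: cap_matrix_def)

lemma dim_cap_bound [simp]: "dim_vec (cap_bound n W c) = 2 * n"
  by (simp add: cap_bound_def)

text \<open>The cap is conditional on \<open>W \<noteq> {}\<close>: for empty \<open>W\<close> no
  row mentions \<open>c\<close>, which may be negative here.\<close>

lemma polyhedron_cap:
  assumes "W \<subseteq> {..<n}"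
  shows "x \<in> polyhedron (cap_matrix n W) (cap_bound n W c) \<longleftrightarrow>
    x \<in> carrier_vec n \<and> (\<forall>i<n. 0 \<le> x $ i) \<and> (\<forall>i<n. i \<notin> W \<longrightarrow> x $ i \<le> 1) \<and>
    (W \<noteq> {} \<longrightarrow> (\<Sum>i\<in>W. x $ i) \<le> c)"
proof (cases "x \<in> carrier_vec n")
  case True
  let ?y = "cap_matrix n W *\<^sub>v x"
  have lower: "?y $ i = x $ i" if "i < n" for i
    using that True
    by (simp add: cap_matrix_def mat_of_rows_row nth_append indicator_vec_scalar_prod)
  have upper: "?y $ (n + i) = - (\<Sum>j\<in>cap_row W i. x $ j)" if "i < n" for i
  proof -
    have "cap_row W i \<subseteq> {..<n}" using that assms by (auto simp: cap_row_def)
    then show ?thesis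
      using that True
      by (simp add: cap_matrix_def mat_of_rows_row nth_append indicator_vec_scalar_prod
          uminus_scalar_prod[symmetric])
  qed
  have split: "(\<forall>i<2 * n. Q i) \<longleftrightarrow> (\<forall>i<n. Q i) \<and> (\<forall>i<n. Q (n + i))" for Q :: "nat \<Rightarrow> bool"
  proof (intro iffI conjI allI impI)
    fix i assume "(\<forall>i<n. Q i) \<and> (\<forall>i<n. Q (n + i))" "i < 2 * n"
    then show "Q i" by (cases "i < n") (auto dest: spec[of _ "i - n"])
  qed auto
  have "?y \<ge> cap_bound n W c \<longleftrightarrow>
      (\<forall>i<n. 0 \<le> x $ i) \<and> (\<forall>i<n. (if i \<in> W then - c else - 1) \<le> - (\<Sum>j\<in>cap_row W i. x $ j))"
    unfolding less_eq_vec_def by (simp add: split lower upper cap_bound_def del: index_mult_mat_vec)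
  also have "\<dots> \<longleftrightarrow> (\<forall>i<n. 0 \<le> x $ i) \<and> (\<forall>i<n. i \<notin> W \<longrightarrow> x $ i \<le> 1) \<and>
      (\<forall>i<n. i \<in> W \<longrightarrow> (\<Sum>i\<in>W. x $ i) \<le> c)"
    by (auto simp: cap_row_def)
  also have "(\<forall>i<n. i \<in> W \<longrightarrow> (\<Sum>i\<in>W. x $ i) \<le> c) \<longleftrightarrow> (W \<noteq> {} \<longrightarrow> (\<Sum>i\<in>W. x $ i) \<le> c)"
    using assms by auto
  finally show ?thesis using True by (simp add: polyhedron_def)
qed (simp add: polyhedron_def)

text \<open>The constraints decouple: coordinates outside \<open>W\<close> range over
  \<open>[0, 1]\<close> independently, those in \<open>W\<close> share a budget \<open>c\<close>. An
  optimum takes 1 outside \<open>W\<close> and spends the whole budget on one coordinate of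
  \<open>T \<inter> W\<close>. It is exhibited explicitly because a relaxation has to attain its
  maximum.\<close>

lemma cap_polyhedron_arg_max:
  assumes "W \<subseteq> {..<n}" "T \<subseteq> {..<n}" "0 \<le> c"
  shows "\<exists>y. is_arg_max (\<lambda>x. indicator_vec n T \<bullet> x)
               (\<lambda>z. z \<in> polyhedron (cap_matrix n W) (cap_bound n W c)) y \<and>
             indicator_vec n T \<bullet> y = real (card (T - W)) + (if T \<inter> W = {} then 0 else c)"
proof -
  define m where "m = real (card (T - W)) + (if T \<inter> W = {} then 0 else c)"
  \<comment> \<open>The coordinate that receives the budget. If \<open>T \<inter> W\<close> is
    empty, \<open>k\<close> is arbitrary, and the condition in \<open>y\<close> makes
    \<open>y\<close> vanish on \<open>W\<close>.\<close>
  define k where "k = (SOME k. k \<in> T \<inter> W)"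
  have k: "k \<in> T \<inter> W" if "T \<inter> W \<noteq> {}" using that some_in_eq unfolding k_def by blast
  define y where "y = vec n (\<lambda>i. if i \<in> W then if T \<inter> W \<noteq> {} \<and> i = k then c else 0 else 1)"
  have fin: "finite T" "finite W" using assms finite_subset by blast+
  have split: "(\<Sum>i\<in>T. x $ i) = (\<Sum>i\<in>T - W. x $ i) + (\<Sum>i\<in>T \<inter> W. x $ i)" for x :: "real vec"
    using fin sum.Int_Diff[of T "\<lambda>i. x $ i" W] by simp
  \<comment> \<open>Applied to \<open>T \<inter> W\<close> for the objective value and to
    \<open>W\<close> for feasibility.\<close>
  have y_W: "(\<Sum>i\<in>U. y $ i) = (if k \<in> U \<and> T \<inter> W \<noteq> {} then c else 0)" if "U \<subseteq> W" for U
  proof -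
    have "(\<Sum>i\<in>U. y $ i) = (\<Sum>i\<in>U. if i = k then if T \<inter> W \<noteq> {} then c else 0 else 0)"
    proof (intro sum.cong refl)
      fix i assume "i \<in> U"
      then have "i \<in> W" "i < n" using that assms(1) by auto
      then show "y $ i = (if i = k then if T \<inter> W \<noteq> {} then c else 0 else 0)" by (simp add: y_def)
    qed
    then show ?thesis using finite_subset[OF that fin(2)] by simp
  qed
  have carrier: "y \<in> carrier_vec n" by (simp add: y_def)
  have "(\<Sum>i\<in>T - W. y $ i) = (\<Sum>i\<in>T - W. 1)"
    using assms(2) by (intro sum.cong) (auto simp: y_def)
  then have value_y: "indicator_vec n T \<bullet> y = m"
    using y_W[of "T \<inter> W"] k by (auto simp: indicator_vec_scalar_prod[OF carrier assms(2)] split m_def)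
  have "y \<in> polyhedron (cap_matrix n W) (cap_bound n W c)"
    unfolding polyhedron_cap[OF assms(1)] using carrier y_W[of W] assms(3) by (auto simp: y_def)
  moreover have "indicator_vec n T \<bullet> z \<le> m"
    if "z \<in> polyhedron (cap_matrix n W) (cap_bound n W c)" for z
  proof -
    from that have z: "z \<in> carrier_vec n" "\<And>i. i < n \<Longrightarrow> 0 \<le> z $ i"
      "\<And>i. i < n \<Longrightarrow> i \<notin> W \<Longrightarrow> z $ i \<le> 1" "W \<noteq> {} \<Longrightarrow> (\<Sum>i\<in>W. z $ i) \<le> c"
      unfolding polyhedron_cap[OF assms(1)] by auto
    have "(\<Sum>i\<in>T - W. z $ i) \<le> (\<Sum>i\<in>T - W. 1)"
      using assms(2) by (intro sum_mono z(3)) auto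
    \<comment> \<open>Nonnegativity of \<open>z\<close> allows enlarging the index set to
      \<open>W\<close>, where the cap applies.\<close>
    moreover have "(\<Sum>i\<in>T \<inter> W. z $ i) \<le> (\<Sum>i\<in>W. z $ i)"
      using assms(1) fin by (intro sum_mono2 z(2)) auto
    moreover have "indicator_vec n T \<bullet> z = (\<Sum>i\<in>T - W. z $ i) + (\<Sum>i\<in>T \<inter> W. z $ i)"
      unfolding indicator_vec_scalar_prod[OF z(1) assms(2)] by (rule split)
    ultimately show ?thesis
    proof (cases "T \<inter> W = {}")
      case False
      then have "(\<Sum>i\<in>W. z $ i) \<le> c" using z(4) by blast
      with \<open>(\<Sum>i\<in>T \<inter> W. z $ i) \<le> _\<close> \<open>(\<Sum>i\<in>T - W. z $ i) \<le> _\<close> \<open>indicator_vec n T \<bullet> z = _\<close> False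
      show ?thesis by (simp add: m_def)
    qed (simp add: m_def)
  qed
  ultimately have "is_arg_max (\<lambda>x. indicator_vec n T \<bullet> x)
      (\<lambda>z. z \<in> polyhedron (cap_matrix n W) (cap_bound n W c)) y"
    using value_y by (simp add: is_arg_max_linorder)
  then show ?thesis using value_y unfolding m_def by blast
qed

section \<open>Application to independent sets\<close>

lemma IndependentSet_simps [simp]:
  "solutions (IndependentSet G) = {I. independent_set G I}"
  "instances (IndependentSet G) = {H. induced_subgraph H G}"
  "Val (IndependentSet G) H I = real (card (I \<inter> verts H))"
  by (simp_all add: IndependentSet_def)

lemma independent_set_subset: "independent_set G I \<Longrightarrow> J \<subseteq> I \<Longrightarrow> independent_set G J"
  by (auto simp: independent_set_def)

lemma (in loopfree_digraph) independent_set_singleton: "v \<in> verts G \<Longrightarrow> independent_set G {v}"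
  using adj_not_same by (auto simp: independent_set_def)

text \<open>The maximum is over independent sets of the whole graph \<open>G\<close>, of which there
  are finitely many, so \<open>Max\<close> is meaningful.\<close>

lemma card_le_OPT_IndependentSet:
  assumes "finite (verts G)" "independent_set G I"
  shows "real (card (I \<inter> verts H)) \<le> OPT (IndependentSet G) H"
proof -
  have "finite {I. independent_set G I}"
    by (rule finite_subset[of _ "Pow (verts G)"]) (auto simp: independent_set_def assms(1))
  then show ?thesis
    using assms(2) by (auto simp: OPT_def intro!: Max_ge)
qed

text \<open>The threshold \<open>sqrt n\<close> balances the two contributions: it bounds both the
  number of removed sets and the cap on the remaining vertices, and each part costs at most
  \<open>sqrt n\<close> times the optimum.\<close>

lemma lp_relaxation_IndependentSet:
  fixes G :: "('a, 'b) pre_digraph"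
  assumes "graph G"
  defines "n \<equiv> card (verts G)"
  shows "\<exists>A b. dim_row A = 2 * n \<and> lp_relaxation (IndependentSet G) (2 * sqrt (real n)) A b"
proof -
  interpret graph G by fact
  let ?t = "sqrt (real n)"
  obtain F W where FW: "finite F" "\<forall>I\<in>F. independent_set G I" "W \<subseteq> verts G"
    "verts G - W \<subseteq> \<Union>F" "real (card F) * ?t \<le> real n"
    "\<forall>I\<subseteq>W. independent_set G I \<longrightarrow> real (card I) \<le> ?t"
    using greedy_decomposition[OF finite_verts, of ?t "independent_set G"] unfolding n_def by auto
  obtain h where h: "bij_betw h {0..<n} (verts G)"
    using ex_bij_betw_nat_finite[OF finite_verts] unfolding n_def by blast
  \<comment> \<open>Translates vertex sets into coordinate sets along the enumeration
    \<open>h\<close>. Elements of \<open>S\<close> that are not vertices are lost, hence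
    \<open>S \<inter> verts G\<close> in \<open>card_idx\<close>.\<close>
  define idx where "idx S = {i \<in> {..<n}. h i \<in> S}" for S
  have idx: "idx S \<subseteq> {..<n}" for S by (auto simp: idx_def)
  have card_idx: "card (idx S) = card (S \<inter> verts G)" for S
  proof -
    have "h ` idx S = S \<inter> verts G"
      using bij_betw_imp_surj_on[OF h] by (force simp: idx_def lessThan_atLeast0)
    moreover have "inj_on h (idx S)"
      by (rule inj_on_subset[OF bij_betw_imp_inj_on[OF h]]) (auto simp: idx_def)
    ultimately show ?thesis using card_image by metis
  qed
  \<comment> \<open>With \<open>S = verts H\<close> this is the value of \<open>I\<close> on the
    instance \<open>H\<close>; with \<open>S = W\<close> it is the left-hand side of the
    cap.\<close>
  have value_idx: "indicator_vec n (idx S) \<bullet> indicator_vec n (idx I) = real (card (I \<inter> S \<inter> verts G))"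
    for S I
  proof -
    have "indicator_vec n (idx S) \<bullet> indicator_vec n (idx I) =
        (\<Sum>i\<in>idx S. if i \<in> idx I then 1 else 0)"
      unfolding indicator_vec_scalar_prod[OF indicator_vec_carrier idx]
      using idx[of S] by (intro sum.cong) auto
    also have "\<dots> = real (card (idx S \<inter> idx I))"
      using finite_subset[OF idx] by (simp add: sum.If_cases Int_def)
    also have "idx S \<inter> idx I = idx (I \<inter> S)" by (auto simp: idx_def)
    finally show ?thesis by (simp add: card_idx)
  qed
  define A where "A = cap_matrix n (idx W)"
  define b where "b = cap_bound n (idx W) ?t"
  have dims: "dim_row A = 2 * n" "dim_col A = n" "dim_vec b = 2 * n"
    by (simp_all add: A_def b_def)
  have feasible: "indicator_vec n (idx I) \<in> polyhedron A b" if "independent_set G I" for I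
  proof -
    have "(\<Sum>i\<in>idx W. indicator_vec n (idx I) $ i) = real (card (I \<inter> W \<inter> verts G))"
      by (simp add: indicator_vec_scalar_prod[OF _ idx, symmetric] value_idx)
    \<comment> \<open>\<open>I \<inter> W\<close> is an independent subset of \<open>W\<close>, so
      the greedy procedure left it with at most \<open>?t\<close> vertices.\<close>
    also have "\<dots> \<le> ?t"
      using independent_set_subset[OF that] FW(6) by (meson inf_le1 inf_le2 le_infI1)
    finally show ?thesis
      unfolding A_def b_def polyhedron_cap[OF idx] by auto
  qed
  \<comment> \<open>The left-hand side is the LP optimum for the instance \<open>H\<close>, written
    with vertices instead of coordinates.\<close>
  have bound: "real (card (S - W)) + (if S \<inter> W = {} then 0 else ?t) \<le> 2 * ?t * OPT (IndependentSet G) H"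
    if S: "S = verts H" "S \<subseteq> verts G" for S and H :: "('a, 'b) pre_digraph"
  \<comment> \<open>For \<open>n = 0\<close> the threshold is 0, and the inequality for
    \<open>card F\<close> says nothing; but then \<open>S\<close> is empty.\<close>
  proof (cases "n = 0")
    case True
    then show ?thesis using S by (simp add: n_def)
  next
    case False
    let ?opt = "OPT (IndependentSet G) H"
    have opt: "real (card (I \<inter> S)) \<le> ?opt" if "independent_set G I" for I
      using card_le_OPT_IndependentSet[OF finite_verts that] S by simp
    have opt_ge_0: "0 \<le> ?opt"
      using opt[of "{}"] by (simp add: independent_set_def)
    have "card (S - W) \<le> card (\<Union>I\<in>F. I \<inter> S)"
      using FW S(2) by (intro card_mono) (auto intro: finite_subset[OF _ finite_verts])
    also have "\<dots> \<le> (\<Sum>I\<in>F. card (I \<inter> S))"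
      by (rule card_UN_le[OF FW(1)])
    finally have "real (card (S - W)) \<le> (\<Sum>I\<in>F. real (card (I \<inter> S)))"
      by (metis of_nat_le_iff of_nat_sum)
    also have "\<dots> \<le> real (card F) * ?opt"
      using FW(2) opt by (intro sum_bounded_above) auto
    also have "\<dots> \<le> ?t * ?opt"
    proof (intro mult_right_mono opt_ge_0)
      \<comment> \<open>Uses \<open>n = ?t * ?t\<close>; cancelling \<open>?t > 0\<close> bounds the
        number of removed sets.\<close>
      have "real (card F) * ?t \<le> ?t * ?t" using FW(5) by simp
      moreover have "0 < ?t" using False by simp
      ultimately show "real (card F) \<le> ?t" by (rule mult_right_le_imp_le)
    qed
    finally have outside: "real (card (S - W)) \<le> ?t * ?opt" .
    have "(if S \<inter> W = {} then 0 else ?t) \<le> ?t * ?opt"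
    proof (cases "S \<inter> W = {}")
      case False
      then obtain v where "v \<in> S" by blast
      then have "1 \<le> ?opt"
        using opt[of "{v}"] independent_set_singleton[of v] S(2) by auto
      then show ?thesis using False mult_left_mono[of 1 ?opt ?t] by simp
    qed (simp add: opt_ge_0)
    with outside show ?thesis by simp
  qed
  have "\<exists>y. is_arg_max (\<lambda>x. indicator_vec n (idx (verts H)) \<bullet> x) (\<lambda>z. z \<in> polyhedron A b) y \<and>
      indicator_vec n (idx (verts H)) \<bullet> y \<le> 2 * ?t * OPT (IndependentSet G) H"
    if H: "verts H \<subseteq> verts G" for H :: "('a, 'b) pre_digraph"
  proof -
    have "idx (verts H) - idx W = idx (verts H - W)" by (auto simp: idx_def)
    then have card: "card (idx (verts H) - idx W) = card (verts H - W)"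
      using H by (simp add: card_idx Int_absorb2 subset_iff)
    \<comment> \<open>The case distinction in the optimum passes from coordinates to vertices
      through \<open>card_idx\<close>, as a finite set is empty iff its cardinality is 0.\<close>
    have "idx (verts H) \<inter> idx W = {} \<longleftrightarrow> idx (verts H \<inter> W) = {}" by (auto simp: idx_def)
    also have "\<dots> \<longleftrightarrow> card (idx (verts H \<inter> W)) = 0"
      using finite_subset[OF idx] by simp
    also have "\<dots> \<longleftrightarrow> verts H \<inter> W = {}"
      using H finite_subset[OF H finite_verts] by (simp add: card_idx Int_absorb2 le_infI1)
    finally have "idx (verts H) \<inter> idx W = {} \<longleftrightarrow> verts H \<inter> W = {}" .
    with bound[OF refl H] card
    have "real (card (idx (verts H) - idx W)) + (if idx (verts H) \<inter> idx W = {} then 0 else ?t)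
        \<le> 2 * ?t * OPT (IndependentSet G) H"
      by simp
    moreover obtain y where
      "is_arg_max (\<lambda>x. indicator_vec n (idx (verts H)) \<bullet> x) (\<lambda>z. z \<in> polyhedron A b) y"
      "indicator_vec n (idx (verts H)) \<bullet> y =
        real (card (idx (verts H) - idx W)) + (if idx (verts H) \<inter> idx W = {} then 0 else ?t)"
      using cap_polyhedron_arg_max[OF idx[of W] idx[of "verts H"], of ?t] unfolding A_def b_def by auto
    ultimately show ?thesis by metis
  qed
  moreover have "verts H \<subseteq> verts G" if "induced_subgraph H G" for H
    using that by (auto simp: induced_subgraph_def subgraph_def)
  moreover have "affine_function n (\<lambda>x. c \<bullet> x)" if "c \<in> carrier_vec n" for c
    unfolding affine_function_def by (rule bexI[OF _ that], rule exI[of _ 0]) simp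
  ultimately have "lp_relaxation (IndependentSet G) (2 * ?t) A b"
    unfolding lp_relaxation_def
    by (intro conjI exI[of _ "\<lambda>I. indicator_vec n (idx I)"]
        exI[of _ "\<lambda>H x. indicator_vec n (idx (verts H)) \<bullet> x"])
      (auto simp: feasible value_idx dims Int_assoc Int_absorb2)
  then show ?thesis
    by (intro exI[of _ A] exI[of _ b]) (simp add: dims)
qed

theorem theorem5:
  shows "\<exists>C :: nat. \<forall>G :: ('a, 'b) pre_digraph. graph G \<longrightarrow>
           fc_plus (IndependentSet G) (2 * sqrt (real (card (verts G)))) \<le> enat (C * card (verts G))"
proof (intro exI[of _ 2] allI impI)
  fix G :: "('a, 'b) pre_digraph"
  assume "graph G"
  \<comment> \<open>The constant 2 counts the rows per vertex: one nonnegativity constraint and one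
    upper bound.\<close>
  then obtain A b where "dim_row A = 2 * card (verts G)"
    "lp_relaxation (IndependentSet G) (2 * sqrt (real (card (verts G)))) A b"
    using lp_relaxation_IndependentSet by blast
  then show "fc_plus (IndependentSet G) (2 * sqrt (real (card (verts G)))) \<le> enat (2 * card (verts G))"
    unfolding fc_plus_def by (intro Inf_lower CollectI) metis
qed

end
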